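(* Let $\mathbf{A}$ be a fixed real $m\times n$ matrix and let $\mathbf{X}=[X_{jk}]$ be a random $m\times n$ real matrix with independent entries such that $\mathbb{E}\mathbf{X}=\mathbf{A}$. Then \[ \mathbb{E}\|\mathbf{A}-\mathbf{X}\|_{\infty\to2}\le 2\Big(\sum_{j,k}\mathrm{Var}(X_{jk})\Big)^{1/2}+2\sqrt{m}\,\inf_{\mathbf{D}}\max_{j}\Big(\sum_{k}\frac{\mathrm{Var}(X_{jk})}{d_k^2}\Big)^{1/2}, \] where the infimum is over all diagonal matrices $\mathbf{D}=\mathrm{diag}(d_1,\dots,d_n)$ with $d_k>0$ for all $k$ and $\mathrm{trace}(\mathbf{D}^2)=\sum_k d_k^2=1$.
   Context: For a real $m\times n$ matrix $\mathbf{B}$, $\|\mathbf{B}\|_{\infty\to2}=\max_{\mathbf{u}\ne\mathbf{0}}\|\mathbf{B}\mathbf{u}\|_2/\|\mathbf{u}\|_\infty$. $\mathrm{Var}(X)=\mathbb{E}(X-\mathbb{E}X)^2$, taking values in $[0,+\infty]$. The index $j$ runs over the $m$ rows and $k$ over the $n$ columns. The expectation of a random matrix is taken entrywise. *)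

theory Defs
  imports "HOL-Probability.Probability"
begin

text \<open>Matrices with \<open>m\<close> rows and \<open>n\<close> columns are elements of \<^typ>\<open>real^'n^'m\<close>;
  \<^const>\<open>infnorm\<close> is the max norm on \<^typ>\<open>real^'n\<close>.\<close>

definition norm_inf_2 :: "real^'n^'m \<Rightarrow> real" where
  "norm_inf_2 B = (SUP u \<in> {u. u \<noteq> 0}. norm (B *v u) / infnorm u)"

text \<open>The supremum is a maximum.\<close>

lemma norm_inf_2_attained:
  fixes B :: "real^'n^'m"
  shows "\<exists>u. u \<noteq> 0 \<and> norm_inf_2 B = norm (B *v u) / infnorm u"
    and "v \<noteq> 0 \<Longrightarrow> norm (B *v v) / infnorm v \<le> norm_inf_2 B"
proof -
  let ?f = "\<lambda>u. norm (B *v u) / infnorm u"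
  let ?S = "sphere (0::real^'n) 1"
  have nz: "infnorm u \<noteq> 0" if "u \<in> ?S" for u :: "real^'n"
    using that by (auto simp: infnorm_eq_0)
  have "continuous_on ?S ?f"
    using nz by (intro continuous_intros continuous_on_divide continuous_on_norm
        linear_continuous_on_compose[OF continuous_on_id]
        continuous_at_imp_continuous_on ballI continuous_infnorm continuous_ident
        matrix_vector_mul_linear) auto
  moreover have "?S \<noteq> {}" by simp
  ultimately obtain u where u: "u \<in> ?S" "\<And>w. w \<in> ?S \<Longrightarrow> ?f w \<le> ?f u"
    using continuous_attains_sup[of ?S ?f] by auto
  have le: "?f w \<le> ?f u" if "w \<noteq> 0" for w
  proof -
    let ?w = "(1 / norm w) *\<^sub>R w"
    have "?f ?w = ?f w"
      using that by (simp add: matrix_vector_mult_scaleR infnorm_mul)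
    moreover have "?w \<in> ?S" using that by simp
    ultimately show ?thesis using u(2) by metis
  qed
  have "u \<noteq> 0" using u(1) by auto
  then have eq: "norm_inf_2 B = ?f u"
    unfolding norm_inf_2_def using le by (intro cSup_eq_maximum) auto
  show "\<exists>u. u \<noteq> 0 \<and> norm_inf_2 B = ?f u" using \<open>u \<noteq> 0\<close> eq by blast
  show "v \<noteq> 0 \<Longrightarrow> ?f v \<le> norm_inf_2 B" using le eq by simp
qed

text \<open>Unlike the Bochner integral \<open>variance\<close> of \<^locale>\<open>prob_space\<close>, which is \<open>0\<close> when
  the square is not integrable, this variance is then \<open>\<infinity>\<close>.\<close>

definition evariance :: "'a measure \<Rightarrow> ('a \<Rightarrow> real) \<Rightarrow> ennreal" where
  "evariance M X = (\<integral>\<^sup>+ x. ennreal ((X x - (\<integral>y. X y \<partial>M))\<^sup>2) \<partial>M)"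

definition ennsqrt :: "ennreal \<Rightarrow> ennreal" where
  "ennsqrt x = (if x = \<infinity> then \<infinity> else ennreal (sqrt (enn2real x)))"

definition diag_mat :: "real^'n \<Rightarrow> real^'n^'n" where
  "diag_mat d = (\<chi> i j. if i = j then d $ i else 0)"

end

theory Submission
  imports Defs
begin

text \<open>Let \<open>D = diag(d)\<close>, \<open>\<parallel>d\<parallel>\<^sub>2 = 1\<close>. Then \<open>B u = (B D\<inverse>) (D u)\<close> and \<open>\<parallel>D u\<parallel>\<^sub>2 \<le> \<parallel>u\<parallel>\<^sub>\<infinity>\<close>, so that
  \<open>\<parallel>B\<parallel>\<^bsub>\<infinity>\<rightarrow>2\<^esub>\<close> is at most the Frobenius norm of \<open>B D\<inverse>\<close>. By Jensen's inequality the expectation of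
  the latter, for \<open>B = A - X\<close>, is at most the square root of the sum of \<open>Var X\<^sub>j\<^sub>k / d\<^sub>k\<^sup>2\<close> over all
  \<open>j, k\<close>, and the sum over the \<open>m\<close> rows is at most \<open>m\<close> times the maximal row sum.\<close>

lemma trace_diag_mat_square:
  fixes d :: "real^'n"
  shows "trace (diag_mat d ** diag_mat d) = (\<Sum>k\<in>UNIV. (d $ k)\<^sup>2)"
  unfolding trace_def matrix_matrix_mult_def diag_mat_def
  by (simp add: if_distrib[where f = "\<lambda>x. x * _"] power2_eq_square cong: if_cong)

lemma norm_inf_2_square_le:
  fixes B :: "real^'n^'m" and d :: "real^'n"
  assumes "\<And>k. 0 < d $ k" and "(\<Sum>k\<in>UNIV. (d $ k)\<^sup>2) = 1"
  shows "(norm_inf_2 B)\<^sup>2 \<le> (\<Sum>j\<in>UNIV. \<Sum>k\<in>UNIV. (B $ j $ k)\<^sup>2 / (d $ k)\<^sup>2)"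
proof -
  obtain u where u: "u \<noteq> 0" "norm_inf_2 B = norm (B *v u) / infnorm u"
    using norm_inf_2_attained(1)[of B] by blast
  \<comment> \<open>The weights \<open>(d $ k)\<^sup>2\<close> sum to 1, so this is a weighted mean
    of the squared coordinates of \<open>u\<close>.\<close>
  have Du: "(\<Sum>k\<in>UNIV. (d $ k * u $ k)\<^sup>2) \<le> (infnorm u)\<^sup>2"
  proof -
    have "(\<Sum>k\<in>UNIV. (d $ k * u $ k)\<^sup>2) \<le> (\<Sum>k\<in>UNIV. (d $ k)\<^sup>2 * (infnorm u)\<^sup>2)"
      using component_le_infnorm_cart[of u]
      by (auto intro!: sum_mono mult_left_mono
          simp: power_mult_distrib abs_le_square_iff[symmetric] infnorm_pos_le)
    also have "\<dots> = (infnorm u)\<^sup>2"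
      using assms(2) by (simp flip: sum_distrib_right)
    finally show ?thesis .
  qed
  have "((B *v u) $ j)\<^sup>2 \<le> (\<Sum>k\<in>UNIV. (B $ j $ k)\<^sup>2 / (d $ k)\<^sup>2) * (infnorm u)\<^sup>2" for j
  proof -
    have "d $ k \<noteq> 0" for k using assms(1)[of k] by simp
    then have "(B *v u) $ j = (\<Sum>k\<in>UNIV. (B $ j $ k / d $ k) * (d $ k * u $ k))"
      by (simp add: matrix_vector_mult_def)
    then have "((B *v u) $ j)\<^sup>2
        \<le> (\<Sum>k\<in>UNIV. (B $ j $ k / d $ k)\<^sup>2) * (\<Sum>k\<in>UNIV. (d $ k * u $ k)\<^sup>2)"
      using Cauchy_Schwarz_ineq_sum by metis
    also have "\<dots> \<le> (\<Sum>k\<in>UNIV. (B $ j $ k / d $ k)\<^sup>2) * (infnorm u)\<^sup>2"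
      using Du by (intro mult_left_mono sum_nonneg) auto
    finally show ?thesis by (simp add: power_divide)
  qed
  then have "(\<Sum>j\<in>UNIV. ((B *v u) $ j)\<^sup>2)
      \<le> (\<Sum>j\<in>UNIV. \<Sum>k\<in>UNIV. (B $ j $ k)\<^sup>2 / (d $ k)\<^sup>2) * (infnorm u)\<^sup>2"
    by (simp add: sum_mono sum_distrib_right[of _ _ "(infnorm u)\<^sup>2"])
  moreover have "(norm (B *v u))\<^sup>2 = (\<Sum>j\<in>UNIV. ((B *v u) $ j)\<^sup>2)"
    by (simp add: norm_vec_def L2_set_def sum_nonneg)
  ultimately show ?thesis
    using u by (simp add: power_divide divide_le_eq infnorm_eq_0)
qed

lemma ennsqrt_square: "(ennsqrt x)\<^sup>2 = x"
  by (cases x) (auto simp: ennsqrt_def ennreal_power)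

text \<open>Lets the final estimate be proved between squares, with infinite values
  included.\<close>

lemma power2_le_imp_le_ennreal:
  fixes a b :: ennreal
  assumes "a\<^sup>2 \<le> b\<^sup>2"
  shows "a \<le> b"
proof (rule ccontr)
  assume "\<not> a \<le> b"
  then have "b\<^sup>2 < a\<^sup>2"
    by (cases a; cases b)
      (auto simp: ennreal_power ennreal_less_iff power_strict_mono)
  with assms show False by simp
qed

text \<open>Cauchy-Schwarz against the constant 1, whose square has integral 1.\<close>

lemma (in prob_space) nn_integral_square_le:
  fixes f :: "'a \<Rightarrow> ennreal"
  assumes "f \<in> borel_measurable M"
  shows "(\<integral>\<^sup>+x. f x \<partial>M)\<^sup>2 \<le> (\<integral>\<^sup>+x. (f x)\<^sup>2 \<partial>M)"
  using Cauchy_Schwarz_nn_integral[OF assms, of "\<lambda>_. 1"] by (simp add: emeasure_space_1)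

lemma nn_integral_norm_inf_2_square_le:
  fixes A :: "real^'n^'m" and X :: "'w \<Rightarrow> real^'n^'m" and d :: "real^'n"
  assumes "prob_space M"
    and int: "\<And>j k. integrable M (\<lambda>\<omega>. X \<omega> $ j $ k)"
    and mean: "\<And>j k. (\<integral>\<omega>. X \<omega> $ j $ k \<partial>M) = A $ j $ k"
    and d: "\<And>k. 0 < d $ k" "(\<Sum>k\<in>UNIV. (d $ k)\<^sup>2) = 1"
  shows "(\<integral>\<^sup>+ \<omega>. ennreal (norm_inf_2 (A - X \<omega>)) \<partial>M)\<^sup>2
    \<le> (\<Sum>j\<in>UNIV. \<Sum>k\<in>UNIV. evariance M (\<lambda>\<omega>. X \<omega> $ j $ k) / ennreal ((d $ k)\<^sup>2))"
proof -
  interpret prob_space M by fact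
  have [measurable]: "(\<lambda>\<omega>. X \<omega> $ j $ k) \<in> borel_measurable M" for j k
    using int by auto
  \<comment> \<open>\<open>F\<close> is the squared Frobenius norm of \<open>A - X \<omega>\<close>
    with column \<open>k\<close> divided by \<open>d $ k\<close>.\<close>
  define F where "F \<omega> = (\<Sum>j\<in>UNIV. \<Sum>k\<in>UNIV. (A $ j $ k - X \<omega> $ j $ k)\<^sup>2 / (d $ k)\<^sup>2)" for \<omega>
  have [measurable]: "F \<in> borel_measurable M" unfolding F_def by measurable
  have F_nonneg: "0 \<le> F \<omega>" for \<omega> unfolding F_def by (intro sum_nonneg) auto
  have "norm_inf_2 (A - X \<omega>) \<le> sqrt (F \<omega>)" for \<omega>
    using norm_inf_2_square_le[OF d, of "A - X \<omega>"] by (auto simp: F_def intro: real_le_rsqrt)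
  \<comment> \<open>Passing to \<open>sqrt (F \<omega>)\<close> first puts an evidently measurable
    integrand into Cauchy-Schwarz.\<close>
  then have "(\<integral>\<^sup>+ \<omega>. ennreal (norm_inf_2 (A - X \<omega>)) \<partial>M)\<^sup>2
      \<le> (\<integral>\<^sup>+ \<omega>. ennreal (sqrt (F \<omega>)) \<partial>M)\<^sup>2"
    by (intro power_mono nn_integral_mono ennreal_leI) auto
  also have "\<dots> \<le> (\<integral>\<^sup>+ \<omega>. (ennreal (sqrt (F \<omega>)))\<^sup>2 \<partial>M)"
    by (intro nn_integral_square_le) measurable
  also have "\<dots> = (\<integral>\<^sup>+ \<omega>. ennreal (F \<omega>) \<partial>M)"
    using F_nonneg by (simp add: ennreal_power)
  also have "\<dots> = (\<integral>\<^sup>+ \<omega>. (\<Sum>j\<in>UNIV. \<Sum>k\<in>UNIV.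
      ennreal ((X \<omega> $ j $ k - A $ j $ k)\<^sup>2) / ennreal ((d $ k)\<^sup>2)) \<partial>M)"
    \<comment> \<open>Real and extended division agree only for nonzero divisors: the former gives 0
      at a zero divisor, the latter \<open>top\<close> for a positive numerator.\<close>
    using d(1)[THEN less_imp_neq, THEN not_sym]
    by (simp add: F_def divide_ennreal sum_nonneg power2_commute)
  also have "\<dots> = (\<Sum>j\<in>UNIV. \<Sum>k\<in>UNIV.
      evariance M (\<lambda>\<omega>. X \<omega> $ j $ k) / ennreal ((d $ k)\<^sup>2))"
    by (simp add: nn_integral_sum nn_integral_divide evariance_def mean)
  finally show ?thesis .
qed

text \<open>Source of the factor \<open>sqrt m\<close>: each of the \<open>m\<close> row sums is at
  most the square of the largest root.\<close>

lemma sum_le_card_mult_Max_ennsqrt_square: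
  fixes S :: "'m::finite \<Rightarrow> ennreal"
  shows "(\<Sum>j\<in>UNIV. S j) \<le> (ennreal (sqrt (real CARD('m))) * (MAX j\<in>UNIV. ennsqrt (S j)))\<^sup>2"
proof -
  define T where "T = (MAX j\<in>UNIV. ennsqrt (S j))"
  have "S j \<le> T\<^sup>2" for j
  proof -
    have "(ennsqrt (S j))\<^sup>2 \<le> T\<^sup>2"
      unfolding T_def by (intro power_mono Max_ge) auto
    then show ?thesis by (simp add: ennsqrt_square)
  qed
  then have "(\<Sum>j\<in>UNIV. S j) \<le> of_nat CARD('m) * T\<^sup>2"
    using sum_bounded_above[of UNIV S "T\<^sup>2"] by simp
  also have "\<dots> = (ennreal (sqrt (real CARD('m))) * T)\<^sup>2"
    by (simp add: power_mult_distrib ennreal_power ennreal_of_nat_eq_real_of_nat)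
  finally show ?thesis unfolding T_def .
qed

text \<open>Multiplication by such a \<open>c\<close> is an order isomorphism, inverted by division.
  The inequality can fail for \<open>c = 0\<close> with \<open>D\<close> empty, and for
  \<open>c = top\<close> when positive values have infimum 0.\<close>

lemma le_mult_INF_ennreal:
  fixes c :: ennreal
  assumes "0 < c" "c < top" and "\<And>d. d \<in> D \<Longrightarrow> L \<le> c * f d"
  shows "L \<le> c * (INF d\<in>D. f d)"
proof -
  have "L / c \<le> (INF d\<in>D. f d)"
    using assms by (intro INF_greatest divide_le_posI_ennreal) (auto simp: mult.commute)
  then have "c * (L / c) \<le> c * (INF d\<in>D. f d)"
    by (rule mult_left_mono) simp
  moreover have "c * (L / c) = L"
    using assms(1,2) by (metis ennreal_divide_self ennreal_divide_times
        ennreal_times_divide less_irrefl mult.commute mult.right_neutral)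
  ultimately show ?thesis by simp
qed

theorem corollary3:
  fixes A :: "real^'n^'m" and M :: "'w measure" and X :: "'w \<Rightarrow> real^'n^'m"
  assumes "prob_space M"
    and "prob_space.indep_vars M (\<lambda>_. borel) (\<lambda>(j, k) \<omega>. X \<omega> $ j $ k) (UNIV :: ('m \<times> 'n) set)"
    and "\<And>j k. integrable M (\<lambda>\<omega>. X \<omega> $ j $ k)"
    and "\<And>j k. (\<integral>\<omega>. X \<omega> $ j $ k \<partial>M) = A $ j $ k"
  shows "(\<integral>\<^sup>+ \<omega>. ennreal (norm_inf_2 (A - X \<omega>)) \<partial>M)
    \<le> 2 * ennsqrt (\<Sum>j\<in>UNIV. \<Sum>k\<in>UNIV. evariance M (\<lambda>\<omega>. X \<omega> $ j $ k))
      + 2 * ennreal (sqrt (real CARD('m))) *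
        (INF d \<in> {d :: real^'n. (\<forall>k. 0 < d $ k) \<and> trace (diag_mat d ** diag_mat d) = 1}.
          MAX j\<in>UNIV. ennsqrt (\<Sum>k\<in>UNIV.
            evariance M (\<lambda>\<omega>. X \<omega> $ j $ k) / ennreal ((d $ k)\<^sup>2)))"
    (is "?L \<le> ?F + 2 * ?c * (INF d \<in> ?D. ?T d)")
proof -
  have "?L \<le> ?c * ?T d" if "d \<in> ?D" for d
  proof (rule power2_le_imp_le_ennreal)
    have "?L\<^sup>2 \<le> (\<Sum>j\<in>UNIV. \<Sum>k\<in>UNIV. evariance M (\<lambda>\<omega>. X \<omega> $ j $ k) / ennreal ((d $ k)\<^sup>2))"
      using that assms by (intro nn_integral_norm_inf_2_square_le) (auto simp: trace_diag_mat_square)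
    also have "\<dots> \<le> (?c * ?T d)\<^sup>2"
      by (rule sum_le_card_mult_Max_ennsqrt_square)
    finally show "?L\<^sup>2 \<le> (?c * ?T d)\<^sup>2" .
  qed
  then have "?L \<le> ?c * (INF d \<in> ?D. ?T d)"
    by (intro le_mult_INF_ennreal) auto
  \<comment> \<open>The bound so far has constant 1 and a single term; doubling it and adding
    \<open>?F\<close> only enlarge it to the stated form.\<close>
  also have "\<dots> \<le> 2 * (?c * (INF d \<in> ?D. ?T d))"
    by (simp add: mult_2)
  also have "\<dots> \<le> ?F + 2 * ?c * (INF d \<in> ?D. ?T d)"
    by (simp add: mult.assoc)
  finally show ?thesis .
qed

end
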